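(* Fix $k\ge2$. Given a classical $k$-XOR instance $\mathcal{I}=(\mathcal{H},\{b_C\}_{C\in\mathcal{H}})$ on $n$ variables, one can compute in polynomial time the description of the Hamiltonian $k$-XOR instance $\mathcal{J}=(\mathcal{H},\{(Z_C,b_C)\}_{C\in\mathcal{H}})$, and it satisfies: 1. $\mathrm{val}(\mathcal{I})=\lambda_{\max}(\mathbf{H}_{\mathcal{J}})$; 2. For every $d$, the degree-$d$ non-commutative Sum-of-Squares value of $\mathbf{H}_{\mathcal{J}}$ equals the degree-$d$ Sum-of-Squares value of $\mathcal{I}$.
   Context: A classical $k$-XOR instance $\mathcal{I}=(\mathcal{H},\{b_C\})$ consists of a $k$-uniform hypergraph $\mathcal{H}$ on $[n]$ and signs $b_C\in\{\pm1\}$, encoding constraints $\prod_{i\in C}x_i=b_C$ over $x\in\{\pm1\}^n$; $\mathrm{val}(\mathcal{I})=\max_{x\in\{\pm1\}^n}\left(\frac12+\frac1{2|\mathcal{H}|}\sum_{C}b_C\prod_{i\in C}x_i\right)$, the maximum fraction of satisfied constraints. $Z_C$ denotes the $n$-qubit Pauli operator acting as $Z$ on each qubit in $C$ and as identity elsewhere, and $\mathbf{H}_{\mathcal{J}}=\frac1{|\mathcal{H}|}\sum_C\frac{\mathrm{Id}+b_CZ_C}{2}$. Degree-$d$ SoS value of $\mathcal{I}$: the maximum of $\tilde{\mathbb{E}}\left[\frac12+\frac1{2|\mathcal{H}|}\sum_Cb_C\prod_{i\in C}x_i\right]$ over linear functionals $\tilde{\mathbb{E}}$ on real multilinear polynomials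 in $x_1,\dots,x_n$ of degree $\le d$ (with $x_i^2$ identified with $1$) satisfying $\tilde{\mathbb{E}}[1]=1$ and $\tilde{\mathbb{E}}[p^2]\ge0$ for all polynomials $p$ of degree $\le d/2$. Degree-$d$ non-commutative SoS value of an $n$-qubit Hamiltonian $\mathbf{H}$: the maximum of $\tilde{\mathbb{E}}[\mathbf{H}]$ over linear functionals $\tilde{\mathbb{E}}$ on operators of degree $\le d$ (degree = largest weight of a Pauli string in the Pauli expansion; weight = number of non-identity tensor factors) with $\tilde{\mathbb{E}}[\mathrm{Id}]=1$ and $\tilde{\mathbb{E}}[\mathbf{B}^\dagger\mathbf{B}]\ge0$ for all operators $\mathbf{B}$ of degree $\le d/2$. *)

theory Defs
  imports
    "HOL-Library.Extended_Real"
    "HOL-Library.FuncSet"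
    "HOL-Computational_Algebra.Polynomial"
    "Jordan_Normal_Form.Schur_Decomposition"
begin

subsection \<open>Classical XOR instances\<close>

text \<open>Variables (and later qubits) are numbered \<open>0, \<dots>, n - 1\<close>. The constraint hypergraph
  is nonempty because the value of an instance divides by the number of constraints.\<close>

definition xor_instance :: "nat \<Rightarrow> nat \<Rightarrow> nat set set \<Rightarrow> (nat set \<Rightarrow> real) \<Rightarrow> bool" where
  "xor_instance k n H b \<longleftrightarrow>
     H \<noteq> {} \<and> (\<forall>C\<in>H. C \<subseteq> {..<n} \<and> card C = k \<and> b C \<in> {1, -1})"

definition xor_val :: "nat \<Rightarrow> nat set set \<Rightarrow> (nat set \<Rightarrow> real) \<Rightarrow> real" where
  "xor_val n H b =
     Max ((\<lambda>x. 1 / 2 + 1 / (2 * real (card H)) * (\<Sum>C\<in>H. b C * (\<Prod>i\<in>C. x i)))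
       ` ({..<n} \<rightarrow>\<^sub>E {1, -1}))"


subsection \<open>Sum-of-Squares\<close>

text \<open>A real multilinear polynomial is given by its coefficients: \<open>p S\<close> is the coefficient of
  the monomial \<open>\<Prod>i\<in>S. x\<^sub>i\<close>. Modulo \<open>x\<^sub>i\<^sup>2 = 1\<close>, the product of the monomials of \<open>T\<close> and \<open>U\<close> is the
  monomial of their symmetric difference.\<close>

type_synonym mlpoly = "nat set \<Rightarrow> real"

definition mlpoly_deg_le :: "nat \<Rightarrow> nat \<Rightarrow> mlpoly \<Rightarrow> bool" where
  "mlpoly_deg_le n d p \<longleftrightarrow> (\<forall>S. p S \<noteq> 0 \<longrightarrow> S \<subseteq> {..<n} \<and> card S \<le> d)"

definition monomial :: "nat set \<Rightarrow> mlpoly" where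
  "monomial S = (\<lambda>T. if T = S then 1 else 0)"

definition mlpoly_mult :: "nat \<Rightarrow> mlpoly \<Rightarrow> mlpoly \<Rightarrow> mlpoly" where
  "mlpoly_mult n p q =
     (\<lambda>S. \<Sum>(T, U) \<in> {(T, U). T \<subseteq> {..<n} \<and> U \<subseteq> {..<n} \<and> (T - U) \<union> (U - T) = S}. p T * q U)"

definition xor_poly :: "nat set set \<Rightarrow> (nat set \<Rightarrow> real) \<Rightarrow> mlpoly" where
  "xor_poly H b =
     (\<lambda>S. 1 / 2 * monomial {} S + 1 / (2 * real (card H)) * (\<Sum>C\<in>H. b C * monomial C S))"

text \<open>Functionals are total functions, but only their values on polynomials of degree at
  most \<open>d\<close> are constrained. As \<open>d\<close> is a natural number, degree at most \<open>d / 2\<close> means degree at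
  most \<open>d div 2\<close>.\<close>

definition pseudo_expectation :: "nat \<Rightarrow> nat \<Rightarrow> (mlpoly \<Rightarrow> real) \<Rightarrow> bool" where
  "pseudo_expectation n d E \<longleftrightarrow>
     (\<forall>p q r s. mlpoly_deg_le n d p \<longrightarrow> mlpoly_deg_le n d q \<longrightarrow>
        E (\<lambda>S. r * p S + s * q S) = r * E p + s * E q) \<and>
     E (monomial {}) = 1 \<and>
     (\<forall>p. mlpoly_deg_le n (d div 2) p \<longrightarrow> 0 \<le> E (mlpoly_mult n p p))"

text \<open>The supremum is taken in the extended reals, so that it needs no side condition. For
  even \<open>d\<close> at least the degree of \<open>f\<close> the feasible region is compact up to irrelevant values
  and the supremum is the maximum.
  Otherwise \<open>f\<close> may contain monomials that positivity leaves unbounded (if \<open>d\<close> is odd), or may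
  lie outside the domain of the functionals (if \<open>d\<close> is below its degree); the value can then
  be \<open>\<infinity>\<close>.\<close>

definition sos_value :: "nat \<Rightarrow> nat \<Rightarrow> mlpoly \<Rightarrow> ereal" where
  "sos_value n d f = (SUP E\<in>{E. pseudo_expectation n d E}. ereal (E f))"


subsection \<open>Pauli operators\<close>

datatype pauli = PI | PX | PY | PZ

fun pauli_matrix :: "pauli \<Rightarrow> complex mat" where
  "pauli_matrix PI = mat_of_rows_list 2 [[1, 0], [0, 1]]"
| "pauli_matrix PX = mat_of_rows_list 2 [[0, 1], [1, 0]]"
| "pauli_matrix PY = mat_of_rows_list 2 [[0, - \<i>], [\<i>, 0]]"
| "pauli_matrix PZ = mat_of_rows_list 2 [[1, 0], [0, - 1]]"

definition pauli_strings :: "nat \<Rightarrow> (nat \<Rightarrow> pauli) set" where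
  "pauli_strings n = {P. \<forall>i. n \<le> i \<longrightarrow> P i = PI}"

definition pauli_supp :: "(nat \<Rightarrow> pauli) \<Rightarrow> nat set" where
  "pauli_supp P = {i. P i \<noteq> PI}"

definition pauli_weight :: "(nat \<Rightarrow> pauli) \<Rightarrow> nat" where
  "pauli_weight P = card (pauli_supp P)"

text \<open>The tensor product of the single-qubit matrices, written out in the computational basis:
  the basis vector with index \<open>r < 2 ^ n\<close> has qubit \<open>i\<close> in the state given by the \<open>i\<close>-th
  binary digit of \<open>r\<close>.\<close>

definition pauli_op :: "nat \<Rightarrow> (nat \<Rightarrow> pauli) \<Rightarrow> complex mat" where
  "pauli_op n P = mat (2 ^ n) (2 ^ n)
     (\<lambda>(r, c). \<Prod>i<n. pauli_matrix (P i) $$ (r div 2 ^ i mod 2, c div 2 ^ i mod 2))"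

definition Z_string :: "nat set \<Rightarrow> nat \<Rightarrow> pauli" where
  "Z_string C = (\<lambda>i. if i \<in> C then PZ else PI)"

definition mat_sum :: "nat \<Rightarrow> ('a \<Rightarrow> complex mat) \<Rightarrow> 'a set \<Rightarrow> complex mat" where
  "mat_sum m f A = mat m m (\<lambda>ij. \<Sum>a\<in>A. f a $$ ij)"


subsection \<open>Hamiltonian XOR instances\<close>

definition ham_xor_instance ::
    "nat \<Rightarrow> nat \<Rightarrow> nat set set \<Rightarrow> (nat set \<Rightarrow> nat \<Rightarrow> pauli) \<Rightarrow> (nat set \<Rightarrow> real) \<Rightarrow> bool" where
  "ham_xor_instance k n H P b \<longleftrightarrow>
     xor_instance k n H b \<and> (\<forall>C\<in>H. P C \<in> pauli_strings n \<and> pauli_supp (P C) = C)"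

definition xor_hamiltonian ::
    "nat \<Rightarrow> nat set set \<Rightarrow> (nat set \<Rightarrow> nat \<Rightarrow> pauli) \<Rightarrow> (nat set \<Rightarrow> real) \<Rightarrow> complex mat" where
  "xor_hamiltonian n H P b =
     (1 / of_nat (card H)) \<cdot>\<^sub>m
       mat_sum (2 ^ n)
         (\<lambda>C. (1 / 2) \<cdot>\<^sub>m (1\<^sub>m (2 ^ n) + complex_of_real (b C) \<cdot>\<^sub>m pauli_op n (P C))) H"

definition lambda_max :: "complex mat \<Rightarrow> real" where
  "lambda_max A = Max {r. eigenvalue A (complex_of_real r)}"


subsection \<open>Non-commutative Sum-of-Squares\<close>

text \<open>The coefficients of the Pauli expansion of an operator are unique, so this says that no
  Pauli string in the expansion of \<open>A\<close> has weight above \<open>d\<close>.\<close>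

definition op_deg_le :: "nat \<Rightarrow> nat \<Rightarrow> complex mat \<Rightarrow> bool" where
  "op_deg_le n d A \<longleftrightarrow>
     (\<exists>c :: (nat \<Rightarrow> pauli) \<Rightarrow> complex.
        A = mat_sum (2 ^ n) (\<lambda>P. c P \<cdot>\<^sub>m pauli_op n P) (pauli_strings n) \<and>
        (\<forall>P\<in>pauli_strings n. c P \<noteq> 0 \<longrightarrow> pauli_weight P \<le> d))"

definition nc_pseudo_expectation :: "nat \<Rightarrow> nat \<Rightarrow> (complex mat \<Rightarrow> complex) \<Rightarrow> bool" where
  "nc_pseudo_expectation n d E \<longleftrightarrow>
     (\<forall>A B u v. op_deg_le n d A \<longrightarrow> op_deg_le n d B \<longrightarrow>
        E (u \<cdot>\<^sub>m A + v \<cdot>\<^sub>m B) = u * E A + v * E B) \<and>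
     E (1\<^sub>m (2 ^ n)) = 1 \<and>
     (\<forall>B. op_deg_le n (d div 2) B \<longrightarrow>
        E (mat_adjoint B * B) \<in> \<real> \<and> 0 \<le> Re (E (mat_adjoint B * B)))"

text \<open>For even \<open>d\<close>, positivity forces \<open>E A\<close> to be real on Hermitian \<open>A\<close> of degree at most \<open>d\<close>, so
  that taking the real part has no effect there.\<close>

definition nc_sos_value :: "nat \<Rightarrow> nat \<Rightarrow> complex mat \<Rightarrow> ereal" where
  "nc_sos_value n d A = (SUP E\<in>{E. nc_pseudo_expectation n d E}. ereal (Re (E A)))"


subsection \<open>Descriptions of instances as strings\<close>

text \<open>A description is the number \<open>n\<close> in binary followed by the constraints in any order, each
  one being its sign and then, for every \<open>i\<close> in the constraint, a letter with index \<open>i\<close> in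
  binary. The letter is \<open>x\<close> in the classical case, and the Pauli acting on qubit \<open>i\<close> in the
  Hamiltonian case (for instance \<open>x101\<close> and \<open>Z101\<close>).\<close>

fun binary :: "nat \<Rightarrow> string" where
  "binary m = (if m < 2 then [] else binary (m div 2)) @ [if even m then CHR ''0'' else CHR ''1'']"

declare binary.simps [simp del]

definition sign_char :: "real \<Rightarrow> char" where
  "sign_char s = (if s = 1 then CHR ''+'' else CHR ''-'')"

fun pauli_char :: "pauli \<Rightarrow> char" where
  "pauli_char PI = CHR ''I''"
| "pauli_char PX = CHR ''X''"
| "pauli_char PY = CHR ''Y''"
| "pauli_char PZ = CHR ''Z''"

definition xor_description :: "nat \<Rightarrow> nat set set \<Rightarrow> (nat set \<Rightarrow> real) \<Rightarrow> string \<Rightarrow> bool" where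
  "xor_description n H b w \<longleftrightarrow>
     (\<exists>Cs. distinct Cs \<and> set Cs = H \<and>
        w = binary n @ concat (map (\<lambda>C. sign_char (b C) #
              concat (map (\<lambda>i. CHR ''x'' # binary i) (sorted_list_of_set C))) Cs))"

definition ham_xor_description ::
    "nat \<Rightarrow> nat set set \<Rightarrow> (nat set \<Rightarrow> nat \<Rightarrow> pauli) \<Rightarrow> (nat set \<Rightarrow> real) \<Rightarrow> string \<Rightarrow> bool" where
  "ham_xor_description n H P b w \<longleftrightarrow>
     (\<exists>Cs. distinct Cs \<and> set Cs = H \<and>
        w = binary n @ concat (map (\<lambda>C. sign_char (b C) #
              concat (map (\<lambda>i. pauli_char (P C i) # binary i) (sorted_list_of_set C))) Cs))"


subsection \<open>Deterministic Turing machines\<close>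

text \<open>Single-tape machines with a two-way infinite tape. The tape alphabet consists of the
  characters and the blank \<open>None\<close>. A machine \<open>(q, \<delta>)\<close> has the states \<open>0, \<dots>, q - 1\<close>, starts in
  state \<open>0\<close> on the first input symbol, and halts when \<open>\<delta>\<close> is undefined.\<close>

datatype head_move = Move_Left | Move_Right | Stay

type_synonym tape_symbol = "char option"

type_synonym turing_machine =
  "nat \<times> (nat \<Rightarrow> tape_symbol \<Rightarrow> (nat \<times> tape_symbol \<times> head_move) option)"

type_synonym tm_config = "nat \<times> (int \<Rightarrow> tape_symbol) \<times> int"

definition wf_turing_machine :: "turing_machine \<Rightarrow> bool" where
  "wf_turing_machine M \<longleftrightarrow>
     0 < fst M \<and>
     (\<forall>q<fst M. \<forall>a q' a' m. snd M q a = Some (q', a', m) \<longrightarrow> q' < fst M)"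

fun move_head :: "head_move \<Rightarrow> int \<Rightarrow> int" where
  "move_head Move_Left h = h - 1"
| "move_head Move_Right h = h + 1"
| "move_head Stay h = h"

fun tm_halted :: "turing_machine \<Rightarrow> tm_config \<Rightarrow> bool" where
  "tm_halted M (q, t, h) \<longleftrightarrow> snd M q (t h) = None"

text \<open>Halting configurations are fixed points of a step.\<close>

fun tm_step :: "turing_machine \<Rightarrow> tm_config \<Rightarrow> tm_config" where
  "tm_step M (q, t, h) =
     (case snd M q (t h) of
        None \<Rightarrow> (q, t, h)
      | Some (q', a, m) \<Rightarrow> (q', t(h := a), move_head m h))"

definition tape_of :: "string \<Rightarrow> int \<Rightarrow> tape_symbol" where
  "tape_of w i = (if 0 \<le> i \<and> nat i < length w then Some (w ! nat i) else None)"

definition computes_within :: "turing_machine \<Rightarrow> nat \<Rightarrow> string \<Rightarrow> string \<Rightarrow> bool" where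
  "computes_within M T w w' \<longleftrightarrow>
     (let c = (tm_step M ^^ T) (0, tape_of w, 0)
      in tm_halted M c \<and> fst (snd c) = tape_of w')"

end

(*
  In the computational basis the diagonal operators are the real functions on the cube, and the
  operator Z_C is the monomial of C. Hence H_J is diagonal with the fractions of satisfied
  constraints as its eigenvalues. A non-commutative pseudo-expectation restricts to the diagonal
  operators; conversely, a classical pseudo-expectation is extended to all operators by first
  discarding the off-diagonal part, which corresponds to keeping only the Z-strings of a Pauli
  expansion. The extension is positive because the diagonal of B^* B is a sum of squares of
  polynomials whose degree is at most that of B. No case distinction on d is needed, not even
  when d is below k, since both maps keep the value at the objective.
*)

theory Submission
  imports Defs
begin

unbundle bit_operations_syntax

subsection \<open>Walsh functions\<close>

text \<open>A point of the cube \<open>{1, -1}\<^sup>n\<close> is encoded by the number \<open>r < 2 ^ n\<close> whose \<open>i\<close>-th binary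
  digit is the exponent of the sign of the \<open>i\<close>-th coordinate, as in the computational basis.\<close>

definition walsh :: "nat set \<Rightarrow> nat \<Rightarrow> real" where
  "walsh S r = (\<Prod>i\<in>S. if bit r i then - 1 else 1)"

definition cube_eval :: "nat \<Rightarrow> mlpoly \<Rightarrow> nat \<Rightarrow> real" where
  "cube_eval n p r = (\<Sum>S\<in>Pow {..<n}. p S * walsh S r)"

text \<open>The Fourier transform on the cube. The value 0 off \<open>Pow {..<n}\<close> lets
  inversion hold as an equality of functions.\<close>

definition walsh_coeffs :: "nat \<Rightarrow> (nat \<Rightarrow> real) \<Rightarrow> mlpoly" where
  "walsh_coeffs n f =
     (\<lambda>S. if S \<subseteq> {..<n} then (\<Sum>r<2 ^ n. f r * walsh S r) / 2 ^ n else 0)"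

section \<open>Bitwise exclusive or on basis indices\<close>

lemma xor_nat_less:
  fixes a r :: nat
  assumes "a < 2 ^ n" "r < 2 ^ n"
  shows "a XOR r < 2 ^ n"
proof -
  have "take_bit n (a XOR r) = a XOR r"
    using assms by (simp add: take_bit_nat_eq_self)
  thus ?thesis by (metis take_bit_nat_less_exp)
qed

lemma bit_nat_imp_less:
  assumes "(r::nat) < 2 ^ n" "bit r i"
  shows "i < n"
  using assms by (metis bit_take_bit_iff take_bit_nat_eq_self)

lemma div_mod_bit: "(r::nat) div 2 ^ i mod 2 = of_bool (bit r i)"
  by (simp add: bit_iff_odd mod_2_eq_odd)

lemma bij_betw_xor:
  fixes a :: nat
  assumes "a < 2 ^ n"
  shows "bij_betw (\<lambda>r. a XOR r) {..<2 ^ n} {..<2 ^ n}"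
proof (rule bij_betwI[where g = "\<lambda>r. a XOR r"])
  show *: "(\<lambda>r. a XOR r) \<in> {..<2 ^ n} \<rightarrow> {..<2 ^ n}"
    using assms xor_nat_less by auto
  show "(\<lambda>r. a XOR r) \<in> {..<2 ^ n} \<rightarrow> {..<2 ^ n}" by (fact *)
qed (simp_all flip: xor.assoc)

section \<open>Orthogonality and Fourier inversion\<close>

lemma walsh_symdiff:
  assumes "finite S" "finite T"
  shows "walsh ((S - T) \<union> (T - S)) r = walsh S r * walsh T r"
proof -
  let ?f = "\<lambda>i. if bit r i then - 1 else 1 :: real"
  have S: "walsh S r = prod ?f (S \<inter> T) * prod ?f (S - T)"
    unfolding walsh_def using assms(1) by (rule prod.Int_Diff)
  have T: "walsh T r = prod ?f (S \<inter> T) * prod ?f (T - S)"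
    unfolding walsh_def Int_commute[of S] using assms(2) by (rule prod.Int_Diff)
  \<comment> \<open>Indices common to both sets contribute the square of a sign.\<close>
  have "prod ?f (S \<inter> T) * prod ?f (S \<inter> T) = 1"
    by (simp flip: prod.distrib add: if_distrib cong: if_cong)
  moreover have "walsh ((S - T) \<union> (T - S)) r = prod ?f (S - T) * prod ?f (T - S)"
    unfolding walsh_def by (rule prod.union_disjoint) (use assms in auto)
  ultimately show ?thesis by (simp add: S T algebra_simps)
qed

lemma sum_walsh:
  assumes "S \<subseteq> {..<n}"
  shows "(\<Sum>r<2 ^ n. walsh S r) = (if S = {} then 2 ^ n else 0)"
proof (cases "S = {}")
  case False
  then obtain j where j: "j \<in> S" by auto
  with assms have jn: "j < n" and fin: "finite S" by (auto intro: finite_subset)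
  \<comment> \<open>Flipping bit \<open>j\<close> permutes the indices below \<open>2 ^ n\<close>
    and negates the summand, so the sum equals its own negative.\<close>
  have flip: "walsh S (2 ^ j XOR r) = - walsh S r" for r
  proof -
    have "walsh (S - {j}) (2 ^ j XOR r) = walsh (S - {j}) r"
      unfolding walsh_def by (rule prod.cong) (auto simp: bit_xor_iff bit_exp_iff)
    thus ?thesis
      unfolding walsh_def prod.remove[OF fin j] by (auto simp: bit_xor_iff bit_exp_iff)
  qed
  have "(\<Sum>r<2 ^ n. walsh S (2 ^ j XOR r)) = (\<Sum>r<2 ^ n. walsh S r)"
    by (rule sum.reindex_bij_betw) (simp add: bij_betw_xor jn)
  thus ?thesis using False by (simp add: flip sum_negf)
qed (simp add: walsh_def)

lemma sum_walsh_mult: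
  assumes "S \<subseteq> {..<n}" "T \<subseteq> {..<n}"
  shows "(\<Sum>r<2 ^ n. walsh S r * walsh T r) = (if S = T then 2 ^ n else 0)"
proof -
  have "(\<Sum>r<2 ^ n. walsh S r * walsh T r) = (\<Sum>r<2 ^ n. walsh ((S - T) \<union> (T - S)) r)"
    using assms by (simp add: walsh_symdiff finite_subset[of _ "{..<n}"])
  also have "\<dots> = (if (S - T) \<union> (T - S) = {} then 2 ^ n else 0)"
    using assms by (intro sum_walsh) auto
  finally show ?thesis by auto
qed

text \<open>Fourier inversion, from the orthogonality of the Walsh functions. It recovers a
  polynomial from its values on the cube.\<close>

lemma walsh_coeffs_eqI:
  assumes p: "mlpoly_deg_le n d p" and f: "\<And>r. r < 2 ^ n \<Longrightarrow> f r = cube_eval n p r"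
  shows "walsh_coeffs n f = p"
proof
  fix S
  show "walsh_coeffs n f S = p S"
  proof (cases "S \<subseteq> {..<n}")
    case True
    have "(\<Sum>r<2 ^ n. f r * walsh S r)
        = (\<Sum>r<2 ^ n. \<Sum>T\<in>Pow {..<n}. p T * (walsh T r * walsh S r))"
      by (intro sum.cong) (auto simp: f cube_eval_def sum_distrib_right mult.assoc)
    also have "\<dots> = (\<Sum>T\<in>Pow {..<n}. p T * (\<Sum>r<2 ^ n. walsh T r * walsh S r))"
      by (subst sum.swap) (simp add: sum_distrib_left)
    also have "\<dots> = (\<Sum>T\<in>Pow {..<n}. if T = S then p T * 2 ^ n else 0)"
      using True by (intro sum.cong) (auto simp: sum_walsh_mult)
    finally show ?thesis using True by (simp add: walsh_coeffs_def)
  qed (use p in \<open>auto simp: walsh_coeffs_def mlpoly_deg_le_def\<close>)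
qed

section \<open>Evaluation on the cube as an algebra homomorphism\<close>

lemma cube_eval_lincomb:
  "cube_eval n (\<lambda>S. u * p S + v * q S) r = u * cube_eval n p r + v * cube_eval n q r"
  by (simp add: cube_eval_def sum.distrib sum_distrib_left algebra_simps)

lemma cube_eval_scale: "cube_eval n (\<lambda>S. u * p S) r = u * cube_eval n p r"
  using cube_eval_lincomb[where v = 0] by simp

lemma cube_eval_sum:
  "cube_eval n (\<lambda>S. \<Sum>a\<in>A. p a S) r = (\<Sum>a\<in>A. cube_eval n (p a) r)"
  unfolding cube_eval_def by (subst sum.swap) (simp add: sum_distrib_right)

lemma cube_eval_monomial:
  assumes "C \<subseteq> {..<n}"
  shows "cube_eval n (monomial C) r = walsh C r"
proof -
  have "cube_eval n (monomial C) r = (\<Sum>S\<in>Pow {..<n}. if S = C then walsh S r else 0)"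
    unfolding cube_eval_def monomial_def by (intro sum.cong) auto
  thus ?thesis using assms by simp
qed

text \<open>Sorting the pairs \<open>(T, U)\<close> by symmetric difference turns the reduced
  product into a plain double sum, which factors because Walsh functions are characters.\<close>

lemma cube_eval_mult:
  "cube_eval n (mlpoly_mult n p q) r = cube_eval n p r * cube_eval n q r"
proof -
  let ?D = "\<lambda>(T, U). (T - U) \<union> (U - T) :: nat set"
  let ?g = "\<lambda>(T, U). p T * q U * walsh ((T - U) \<union> (U - T)) r"
  have "cube_eval n (mlpoly_mult n p q) r =
      (\<Sum>S\<in>Pow {..<n}. \<Sum>x\<in>{x \<in> Pow {..<n} \<times> Pow {..<n}. ?D x = S}. ?g x)"
    unfolding cube_eval_def mlpoly_mult_def sum_distrib_right
    by (intro sum.cong) auto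
  also have "\<dots> = (\<Sum>x\<in>Pow {..<n} \<times> Pow {..<n}. ?g x)"
    by (rule sum.group) auto
  also have "\<dots> = (\<Sum>(T, U)\<in>Pow {..<n} \<times> Pow {..<n}. (p T * walsh T r) * (q U * walsh U r))"
    by (intro sum.cong) (auto simp: walsh_symdiff finite_subset[of _ "{..<n}"])
  also have "\<dots> = cube_eval n p r * cube_eval n q r"
    unfolding cube_eval_def sum_product sum.cartesian_product ..
  finally show ?thesis .
qed

section \<open>Degree bounds\<close>

lemma mlpoly_deg_le_lincomb:
  assumes "mlpoly_deg_le n d p" "mlpoly_deg_le n d q"
  shows "mlpoly_deg_le n d (\<lambda>S. u * p S + v * q S)"
  using assms unfolding mlpoly_deg_le_def by (metis add_0 mult_zero_right)

lemma mlpoly_deg_le_scale: "mlpoly_deg_le n d p \<Longrightarrow> mlpoly_deg_le n d (\<lambda>S. u * p S)"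
  by (simp add: mlpoly_deg_le_def)

lemma mlpoly_deg_le_sum:
  assumes "\<And>a. a \<in> A \<Longrightarrow> mlpoly_deg_le n d (p a)"
  shows "mlpoly_deg_le n d (\<lambda>S. \<Sum>a\<in>A. p a S)"
  using assms unfolding mlpoly_deg_le_def by (metis (no_types, lifting) sum.neutral)

lemma mlpoly_deg_le_monomial:
  assumes "C \<subseteq> {..<n}" "card C \<le> d"
  shows "mlpoly_deg_le n d (monomial C)"
  using assms by (auto simp: mlpoly_deg_le_def monomial_def)

lemma mlpoly_deg_le_mult:
  assumes p: "mlpoly_deg_le n d p" and q: "mlpoly_deg_le n e q"
  shows "mlpoly_deg_le n (d + e) (mlpoly_mult n p q)"
  unfolding mlpoly_deg_le_def
proof (intro allI impI)
  fix S assume "mlpoly_mult n p q S \<noteq> 0"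
  then obtain T U where TU: "T \<subseteq> {..<n}" "U \<subseteq> {..<n}" "S = (T - U) \<union> (U - T)" "p T * q U \<noteq> 0"
    unfolding mlpoly_mult_def by (auto elim!: sum.not_neutral_contains_not_neutral)
  hence "card T \<le> d" "card U \<le> e" using p q by (auto simp: mlpoly_deg_le_def)
  moreover have "card S \<le> card (T \<union> U)"
    using TU by (intro card_mono) (auto simp: finite_subset[of _ "{..<n}"])
  ultimately show "S \<subseteq> {..<n} \<and> card S \<le> d + e"
    using TU card_Un_le[of T U] by auto
qed

section \<open>Linearity of pseudo-expectations\<close>

lemma pseudo_expectation_zero:
  assumes "pseudo_expectation n d E"
  shows "E (\<lambda>S. 0) = 0"
proof -
  have "mlpoly_deg_le n d (\<lambda>S. 0)" by (simp add: mlpoly_deg_le_def)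
  hence "E (\<lambda>S. 0 * 0 + 0 * 0) = 0 * E (\<lambda>S. 0) + 0 * E (\<lambda>S. 0)"
    using assms unfolding pseudo_expectation_def by blast
  thus ?thesis by simp
qed

lemma pseudo_expectation_sum:
  assumes E: "pseudo_expectation n d E" and "finite A"
    and "\<And>a. a \<in> A \<Longrightarrow> mlpoly_deg_le n d (p a)"
  shows "E (\<lambda>S. \<Sum>a\<in>A. p a S) = (\<Sum>a\<in>A. E (p a))"
  using assms(2,3)
proof (induction A rule: finite_induct)
  case empty
  thus ?case using pseudo_expectation_zero[OF E] by simp
next
  case (insert x F)
  have "E (\<lambda>S. 1 * p x S + 1 * (\<Sum>a\<in>F. p a S)) = 1 * E (p x) + 1 * E (\<lambda>S. \<Sum>a\<in>F. p a S)"
    using E insert.prems mlpoly_deg_le_sum[of F n d p]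
    unfolding pseudo_expectation_def by blast
  thus ?case using insert by simp
qed


subsection \<open>Matrix entries of Pauli operators\<close>

lemma finite_pauli_strings: "finite (pauli_strings n)"
proof -
  have "(UNIV :: pauli set) = {PI, PX, PY, PZ}"
    using pauli.exhaust by blast
  hence "finite (UNIV :: pauli set)" by (metis finite.simps)
  hence "finite {P. \<forall>i. (i \<in> {..<n} \<longrightarrow> P i \<in> (UNIV :: pauli set)) \<and> (i \<notin> {..<n} \<longrightarrow> P i = PI)}"
    by (intro finite_set_of_finite_funs) auto
  thus ?thesis by (simp add: pauli_strings_def not_less)
qed

lemma pauli_supp_subset: "P \<in> pauli_strings n \<Longrightarrow> pauli_supp P \<subseteq> {..<n}"
  unfolding pauli_strings_def pauli_supp_def by (auto simp: not_le[symmetric])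

lemma pauli_supp_Z_string: "pauli_supp (Z_string C) = C"
  by (auto simp: pauli_supp_def Z_string_def)

lemma Z_string_in_pauli_strings: "C \<subseteq> {..<n} \<Longrightarrow> Z_string C \<in> pauli_strings n"
  by (auto simp: pauli_strings_def Z_string_def)

text \<open>Here \<open>x\<close> is the column and \<open>s\<close> says whether row and column
  differ. For fixed \<open>s\<close>, the entries do not depend on \<open>x\<close> for
  \<open>PI\<close> and \<open>PX\<close> and pick up the factor -1 at \<open>x\<close> for
  \<open>PY\<close> and \<open>PZ\<close>.\<close>

lemma pauli_matrix_entry:
  "pauli_matrix Q $$ (of_bool (x \<noteq> s), of_bool x) =
     pauli_matrix Q $$ (of_bool s, 0) * (if Q \<in> {PY, PZ} \<and> x then - 1 else 1)"
  by (cases Q; cases x; cases s) (simp_all add: mat_of_rows_list_def)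

lemma prod_sign_filter:
  assumes "S \<subseteq> {..<n}"
  shows "(\<Prod>i<n. if i \<in> S \<and> bit r i then - 1 else 1 :: complex) = of_real (walsh S r)"
proof -
  have "(\<Prod>i\<in>S. if i \<in> S \<and> bit r i then - 1 else 1 :: complex)
      = (\<Prod>i<n. if i \<in> S \<and> bit r i then - 1 else 1)"
    by (rule prod.mono_neutral_left) (use assms in auto)
  thus ?thesis by (simp add: walsh_def if_distrib cong: if_cong)
qed

text \<open>For a fixed offset \<open>a\<close> between row and column, a Pauli string becomes a
  multiple of a single Walsh function. Its set, the Y and Z positions, lies in the support, so
  weight controls degree.\<close>

lemma pauli_op_entry:
  assumes "r < 2 ^ n" "a < 2 ^ n"
  shows "pauli_op n P $$ (r XOR a, r) =
    (\<Prod>i<n. pauli_matrix (P i) $$ (of_bool (bit a i), 0)) *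
    of_real (walsh {i \<in> {..<n}. P i \<in> {PY, PZ}} r)"
proof -
  have "pauli_op n P $$ (r XOR a, r) =
      (\<Prod>i<n. pauli_matrix (P i) $$ (of_bool (bit r i \<noteq> bit a i), of_bool (bit r i)))"
    using assms by (simp add: pauli_op_def xor_nat_less div_mod_bit bit_xor_iff)
  also have "\<dots> = (\<Prod>i<n. pauli_matrix (P i) $$ (of_bool (bit a i), 0) *
      (if i \<in> {i \<in> {..<n}. P i \<in> {PY, PZ}} \<and> bit r i then - 1 else 1))"
    by (intro prod.cong refl, subst pauli_matrix_entry) auto
  finally show ?thesis
    by (subst prod_sign_filter[symmetric]) (auto simp: prod.distrib)
qed

lemma pauli_op_Z_string:
  assumes C: "C \<subseteq> {..<n}" and r: "r < 2 ^ n" and c: "c < 2 ^ n"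
  shows "pauli_op n (Z_string C) $$ (r, c) = (if r = c then of_real (walsh C r) else 0)"
proof (cases "r = c")
  case True
  \<comment> \<open>Offset 0 singles out the diagonal; the scalar is a product of upper left
    entries, all equal to 1.\<close>
  have "(\<Prod>i<n. pauli_matrix (Z_string C i) $$ (of_bool (bit 0 i), 0)) = 1"
    by (intro prod.neutral) (auto simp: Z_string_def mat_of_rows_list_def)
  moreover have "{i \<in> {..<n}. Z_string C i \<in> {PY, PZ}} = C"
    using C by (auto simp: Z_string_def)
  ultimately show ?thesis
    using pauli_op_entry[OF r, of 0 "Z_string C"] True by simp
next
  case False
  then obtain i where i: "bit r i \<noteq> bit c i" using bit_eqI by blast
  hence "i < n" using bit_nat_imp_less r c by blast
  moreover have "pauli_matrix (Z_string C i) $$ (r div 2 ^ i mod 2, c div 2 ^ i mod 2) = 0"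
    using i by (cases "bit r i"; cases "bit c i")
      (auto simp: div_mod_bit Z_string_def mat_of_rows_list_def)
  ultimately show ?thesis using False r c
    by (auto simp: pauli_op_def intro!: prod_zero)
qed

lemma mat_sum_carrier: "mat_sum m f A \<in> carrier_mat m m"
  by (simp add: mat_sum_def)

lemma op_deg_le_carrier: "op_deg_le n d A \<Longrightarrow> A \<in> carrier_mat (2 ^ n) (2 ^ n)"
  unfolding op_deg_le_def using mat_sum_carrier by metis

text \<open>Sums the single-string formula over a Pauli expansion. Offset 0 gives the diagonal; all
  offsets together exhaust each column, as the diagonal of \<open>mat_adjoint B * B\<close>
  requires.\<close>

lemma op_deg_le_entries:
  assumes A: "op_deg_le n d A" and a: "a < 2 ^ n"
  obtains p q where "mlpoly_deg_le n d p" "mlpoly_deg_le n d q"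
    "\<And>r. r < 2 ^ n \<Longrightarrow> A $$ (r XOR a, r) = Complex (cube_eval n p r) (cube_eval n q r)"
proof -
  obtain c where Ac: "A = mat_sum (2 ^ n) (\<lambda>P. c P \<cdot>\<^sub>m pauli_op n P) (pauli_strings n)"
    and c: "\<And>P. P \<in> pauli_strings n \<Longrightarrow> c P \<noteq> 0 \<Longrightarrow> pauli_weight P \<le> d"
    using A unfolding op_deg_le_def by blast
  define \<alpha> where "\<alpha> P = c P * (\<Prod>i<n. pauli_matrix (P i) $$ (of_bool (bit a i), 0))" for P
  define T where "T P = {i \<in> {..<n}. P i \<in> {PY, PZ}}" for P
  \<comment> \<open>Several strings can share one set \<open>T P\<close>, as exchanging
    \<open>PI\<close> with \<open>PX\<close> or \<open>PY\<close> with \<open>PZ\<close> does not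
    change it; hence the sum runs over strings.\<close>
  define poly_of where "poly_of f = (\<lambda>S. \<Sum>P\<in>pauli_strings n. f P * monomial (T P) S)"
    for f :: "(nat \<Rightarrow> pauli) \<Rightarrow> real"
  have T: "T P \<subseteq> {..<n}" for P by (auto simp: T_def)
  \<comment> \<open>Stated for the real and the imaginary part of \<open>\<alpha>\<close> at once;
    both vanish wherever \<open>c\<close> does.\<close>
  have deg: "mlpoly_deg_le n d (poly_of f)"
    if f: "\<And>P. f P \<noteq> 0 \<Longrightarrow> \<alpha> P \<noteq> 0" for f :: "(nat \<Rightarrow> pauli) \<Rightarrow> real"
    unfolding poly_of_def
  proof (rule mlpoly_deg_le_sum)
    fix P assume P: "P \<in> pauli_strings n"
    show "mlpoly_deg_le n d (\<lambda>S. f P * monomial (T P) S)"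
    proof (cases "f P = 0")
      case False
      hence "c P \<noteq> 0" using f by (auto simp: \<alpha>_def)
      hence "pauli_weight P \<le> d" using c P by blast
      moreover have "card (T P) \<le> pauli_weight P"
        unfolding pauli_weight_def using pauli_supp_subset[OF P]
        by (intro card_mono) (auto simp: T_def pauli_supp_def intro: finite_subset)
      ultimately have "mlpoly_deg_le n d (monomial (T P))"
        using T by (intro mlpoly_deg_le_monomial) auto
      thus ?thesis by (rule mlpoly_deg_le_scale)
    qed (simp add: mlpoly_deg_le_def)
  qed
  have ev: "cube_eval n (poly_of f) r = (\<Sum>P\<in>pauli_strings n. f P * walsh (T P) r)" for f r
    unfolding poly_of_def cube_eval_sum using T
    by (simp add: cube_eval_monomial cube_eval_scale)
  show thesis
  proof (rule that)
    show "mlpoly_deg_le n d (poly_of (\<lambda>P. Re (\<alpha> P)))" by (rule deg) auto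
    show "mlpoly_deg_le n d (poly_of (\<lambda>P. Im (\<alpha> P)))" by (rule deg) auto
    fix r :: nat assume r: "r < 2 ^ n"
    have "A $$ (r XOR a, r) = (\<Sum>P\<in>pauli_strings n. (c P \<cdot>\<^sub>m pauli_op n P) $$ (r XOR a, r))"
      using r a by (simp add: Ac mat_sum_def xor_nat_less)
    also have "\<dots> = (\<Sum>P\<in>pauli_strings n. c P * pauli_op n P $$ (r XOR a, r))"
      using r a by (simp add: pauli_op_def xor_nat_less)
    also have "\<dots> = (\<Sum>P\<in>pauli_strings n. \<alpha> P * of_real (walsh (T P) r))"
      using r a by (simp add: pauli_op_entry \<alpha>_def T_def mult.assoc)
    finally show "A $$ (r XOR a, r) =
        Complex (cube_eval n (poly_of (\<lambda>P. Re (\<alpha> P))) r) (cube_eval n (poly_of (\<lambda>P. Im (\<alpha> P))) r)"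
      by (simp add: ev complex_eq_iff)
  qed
qed


subsection \<open>Diagonal operators\<close>

text \<open>The representation of polynomials by diagonal operators that sends the monomial of
  \<open>C\<close> to the operator of \<open>Z_string C\<close>.\<close>

definition cube_op :: "nat \<Rightarrow> mlpoly \<Rightarrow> complex mat" where
  "cube_op n p =
     mat (2 ^ n) (2 ^ n) (\<lambda>(r, c). if r = c then of_real (cube_eval n p r) else 0)"

lemma op_deg_le_cube_op:
  assumes "mlpoly_deg_le n d p"
  shows "op_deg_le n d (cube_op n p)"
proof -
  \<comment> \<open>The condition on \<open>P\<close> selects the strings made of \<open>PI\<close>
    and \<open>PZ\<close> only.\<close>
  define c :: "(nat \<Rightarrow> pauli) \<Rightarrow> complex"
    where "c P = (if P = Z_string (pauli_supp P) then of_real (p (pauli_supp P)) else 0)" for P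
  have "(\<Sum>P\<in>pauli_strings n. c P * pauli_op n P $$ (i, j)) =
      (if i = j then of_real (cube_eval n p i) else 0)"
    if ij: "i < 2 ^ n" "j < 2 ^ n" for i j
  proof -
    have "(\<Sum>P\<in>pauli_strings n. c P * pauli_op n P $$ (i, j)) =
        (\<Sum>P\<in>Z_string ` Pow {..<n}. c P * pauli_op n P $$ (i, j))"
    proof (rule sum.mono_neutral_right)
      show "\<forall>P\<in>pauli_strings n - Z_string ` Pow {..<n}. c P * pauli_op n P $$ (i, j) = 0"
        using pauli_supp_subset by (fastforce simp: c_def)
    qed (auto simp: finite_pauli_strings Z_string_in_pauli_strings)
    also have "\<dots> = (\<Sum>S\<in>Pow {..<n}. c (Z_string S) * pauli_op n (Z_string S) $$ (i, j))"
      by (rule sum.reindex[unfolded o_def]) (metis inj_onI pauli_supp_Z_string)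
    also have "\<dots> = (\<Sum>S\<in>Pow {..<n}. if i = j then of_real (p S * walsh S i) else 0)"
      using ij by (intro sum.cong) (auto simp: c_def pauli_supp_Z_string pauli_op_Z_string)
    finally show ?thesis by (simp add: cube_eval_def)
  qed
  hence "cube_op n p = mat_sum (2 ^ n) (\<lambda>P. c P \<cdot>\<^sub>m pauli_op n P) (pauli_strings n)"
    by (intro eq_matI) (auto simp: cube_op_def mat_sum_def pauli_op_def)
  moreover have "pauli_weight P \<le> d" if "c P \<noteq> 0" for P
    using that assms by (auto simp: c_def pauli_weight_def mlpoly_deg_le_def split: if_splits)
  ultimately show ?thesis unfolding op_deg_le_def by blast
qed

lemma cube_op_lincomb:
  "cube_op n (\<lambda>S. u * p S + v * q S) = of_real u \<cdot>\<^sub>m cube_op n p + of_real v \<cdot>\<^sub>m cube_op n q"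
  by (intro eq_matI) (auto simp: cube_op_def cube_eval_lincomb)

lemma cube_op_one: "cube_op n (monomial {}) = 1\<^sub>m (2 ^ n)"
  by (intro eq_matI) (auto simp: cube_op_def cube_eval_monomial walsh_def)

lemma mat_adjoint_mult_entry:
  assumes B: "B \<in> carrier_mat m m" and "i < m" "j < m"
  shows "(mat_adjoint B * B) $$ (i, j) = (\<Sum>l<m. cnj (B $$ (l, i)) * B $$ (l, j))"
  using assms
  by (auto simp: mat_adjoint_def mat_of_rows_def scalar_prod_def atLeast0LessThan intro!: sum.cong)

text \<open>A real diagonal operator is its own adjoint, so both sides square the values of
  \<open>p\<close> pointwise. This carries positivity from operator squares to polynomial
  squares.\<close>

lemma cube_op_mult:
  "cube_op n (mlpoly_mult n p p) = mat_adjoint (cube_op n p) * cube_op n p"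
proof (rule eq_matI)
  fix i j
  assume "i < dim_row (mat_adjoint (cube_op n p) * cube_op n p)"
    and "j < dim_col (mat_adjoint (cube_op n p) * cube_op n p)"
  hence ij: "i < 2 ^ n" "j < 2 ^ n"
    by (simp_all add: cube_op_def mat_adjoint_def)
  have "(mat_adjoint (cube_op n p) * cube_op n p) $$ (i, j) =
      (\<Sum>l<2 ^ n. cnj (cube_op n p $$ (l, i)) * cube_op n p $$ (l, j))"
    by (rule mat_adjoint_mult_entry) (use ij in \<open>auto simp: cube_op_def\<close>)
  also have "\<dots> = (\<Sum>l<2 ^ n. if l = i then cnj (cube_op n p $$ (l, i)) * cube_op n p $$ (l, j) else 0)"
    using ij by (intro sum.cong) (auto simp: cube_op_def)
  finally show "cube_op n (mlpoly_mult n p p) $$ (i, j) =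
      (mat_adjoint (cube_op n p) * cube_op n p) $$ (i, j)"
    using ij by (auto simp: cube_op_def cube_eval_mult)
qed (simp_all add: cube_op_def mat_adjoint_def)

lemma eigenvalue_cube_op:
  "eigenvalue (cube_op n p) x \<longleftrightarrow> (\<exists>r<2 ^ n. x = of_real (cube_eval n p r))"
proof -
  have carr: "cube_op n p \<in> carrier_mat (2 ^ n) (2 ^ n)" by (simp add: cube_op_def)
  have "upper_triangular (cube_op n p)" by (auto simp: cube_op_def)
  hence "char_poly (cube_op n p) = (\<Prod>a\<leftarrow>diag_mat (cube_op n p). [:- a, 1:])"
    by (rule char_poly_upper_triangular[OF carr])
  hence "eigenvalue (cube_op n p) x \<longleftrightarrow> x \<in> set (diag_mat (cube_op n p))"
    by (auto simp: eigenvalue_root_char_poly[OF carr] poly_prod_list prod_list_zero_iff)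
  also have "\<dots> \<longleftrightarrow> (\<exists>r<2 ^ n. x = of_real (cube_eval n p r))"
    by (auto simp: diag_mat_def cube_op_def)
  finally show ?thesis .
qed


subsection \<open>XOR instances\<close>

lemma xor_instance_finite: "xor_instance k n H b \<Longrightarrow> finite H"
  unfolding xor_instance_def by (metis Pow_iff finite_Pow_iff finite_lessThan finite_subset subsetI)

lemma mlpoly_deg_le_xor_poly:
  assumes "xor_instance k n H b"
  shows "mlpoly_deg_le n k (xor_poly H b)"
proof -
  have "mlpoly_deg_le n k (\<lambda>S. \<Sum>C\<in>H. b C * monomial C S)"
    using assms unfolding xor_instance_def
    by (intro mlpoly_deg_le_sum mlpoly_deg_le_scale mlpoly_deg_le_monomial) auto
  thus ?thesis unfolding xor_poly_def
    by (intro mlpoly_deg_le_lincomb) (auto intro: mlpoly_deg_le_monomial)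
qed

lemma cube_eval_xor_poly:
  assumes "xor_instance k n H b"
  shows "cube_eval n (xor_poly H b) r =
    1 / 2 + 1 / (2 * real (card H)) * (\<Sum>C\<in>H. b C * walsh C r)"
proof -
  have "cube_eval n (\<lambda>S. b C * monomial C S) r = b C * walsh C r" if "C \<in> H" for C
    using that assms by (simp add: cube_eval_scale cube_eval_monomial xor_instance_def)
  thus ?thesis unfolding xor_poly_def cube_eval_lincomb cube_eval_sum
    by (simp add: cube_eval_monomial walsh_def)
qed

text \<open>Reduces both claims about the Hamiltonian to claims about \<open>cube_op\<close>. As
  \<open>H\<close> is finite and nonempty, the constants 1/2 average to 1/2.\<close>

lemma xor_hamiltonian_eq_cube_op:
  assumes I: "xor_instance k n H b"
  shows "xor_hamiltonian n H Z_string b = cube_op n (xor_poly H b)"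
proof (rule eq_matI)
  fix i j
  assume "i < dim_row (cube_op n (xor_poly H b))" "j < dim_col (cube_op n (xor_poly H b))"
  hence ij: "i < 2 ^ n" "j < 2 ^ n" by (simp_all add: cube_op_def)
  have card: "card H > 0"
    using I xor_instance_finite[OF I] by (auto simp: xor_instance_def card_gt_0_iff)
  have "xor_hamiltonian n H Z_string b $$ (i, j) = 1 / of_nat (card H) *
      (\<Sum>C\<in>H. 1 / 2 * ((if i = j then 1 else 0) + of_real (b C) * pauli_op n (Z_string C) $$ (i, j)))"
    using ij by (simp add: xor_hamiltonian_def mat_sum_def pauli_op_def)
  also have "\<dots> = 1 / of_nat (card H) *
      (\<Sum>C\<in>H. 1 / 2 * (if i = j then 1 + of_real (b C * walsh C i) else 0))"
    using I ij by (intro arg_cong2[where f = "(*)"] sum.cong refl)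
      (auto simp: pauli_op_Z_string xor_instance_def)
  also have "\<dots> = cube_op n (xor_poly H b) $$ (i, j)"
    using card ij
    by (auto simp: cube_op_def cube_eval_xor_poly[OF I] sum.distrib divide_simps
        simp flip: sum_divide_distrib)
  finally show "xor_hamiltonian n H Z_string b $$ (i, j) = cube_op n (xor_poly H b) $$ (i, j)" .
qed (simp_all add: cube_op_def xor_hamiltonian_def mat_sum_def)

lemma cube_as_signs:
  "(\<lambda>r::nat. \<lambda>i\<in>{..<n}. if bit r i then - 1 else 1) ` {..<2 ^ n} = {..<n} \<rightarrow>\<^sub>E {1, - 1 :: real}"
proof
  show "{..<n} \<rightarrow>\<^sub>E {1, - 1 :: real} \<subseteq>
      (\<lambda>r::nat. \<lambda>i\<in>{..<n}. if bit r i then - 1 else 1) ` {..<2 ^ n}"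
  proof
    fix x :: "nat \<Rightarrow> real" assume x: "x \<in> {..<n} \<rightarrow>\<^sub>E {1, - 1}"
    \<comment> \<open>Digit \<open>i\<close> is 1 exactly where \<open>x\<close> takes the value
      -1.\<close>
    define r :: nat where "r = horner_sum of_bool 2 (map (\<lambda>i. x i = - 1) [0..<n])"
    have "r < 2 ^ n"
      using horner_sum_of_bool_2_less[of "map (\<lambda>i. x i = - 1) [0..<n]", where ?'a = nat]
      by (simp add: r_def)
    moreover have "x = (\<lambda>i\<in>{..<n}. if bit r i then - 1 else 1)"
    proof
      fix i show "x i = (\<lambda>i\<in>{..<n}. if bit r i then - 1 else 1) i"
        using x by (cases "i < n")
          (auto simp: r_def bit_horner_sum_bit_iff PiE_def Pi_def extensional_def)
    qed
    ultimately show "x \<in> (\<lambda>r::nat. \<lambda>i\<in>{..<n}. if bit r i then - 1 else 1) ` {..<2 ^ n}" by blast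
  qed
qed (auto split: if_splits)

lemma xor_val_eq_lambda_max:
  assumes I: "xor_instance k n H b"
  shows "xor_val n H b = lambda_max (xor_hamiltonian n H Z_string b)"
proof -
  \<comment> \<open>The \<open>undefined\<close> stems from the restricted function that encodes a
    point; a constraint reads only coordinates below \<open>n\<close>.\<close>
  have prod: "(\<Prod>i\<in>C. if i < n then if bit r i then - 1 else 1 else undefined) = walsh C r"
    if "C \<in> H" for C r
    unfolding walsh_def using that I
    by (intro prod.cong) (auto simp: xor_instance_def subset_iff)
  have "xor_val n H b = Max (cube_eval n (xor_poly H b) ` {..<2 ^ n})"
    unfolding xor_val_def cube_as_signs[symmetric] image_image cube_eval_xor_poly[OF I]
    by (simp add: prod)
  \<comment> \<open>The values of the objective on the cube are the diagonal entries, that is, the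
    eigenvalues.\<close>
  also have "cube_eval n (xor_poly H b) ` {..<2 ^ n} =
      {r. eigenvalue (xor_hamiltonian n H Z_string b) (complex_of_real r)}"
    by (auto simp: xor_hamiltonian_eq_cube_op[OF I] eigenvalue_cube_op)
  finally show ?thesis by (simp add: lambda_max_def)
qed


subsection \<open>Transfer of pseudo-expectations\<close>

text \<open>Restriction to diagonal operators; taking real parts commutes with real scalars.\<close>

lemma pseudo_expectation_cube_op:
  assumes E: "nc_pseudo_expectation n d E"
  shows "pseudo_expectation n d (\<lambda>p. Re (E (cube_op n p)))"
  unfolding pseudo_expectation_def
proof (intro conjI allI impI)
  fix p q :: mlpoly and r s :: real
  assume "mlpoly_deg_le n d p" "mlpoly_deg_le n d q"
  hence "E (of_real r \<cdot>\<^sub>m cube_op n p + of_real s \<cdot>\<^sub>m cube_op n q) =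
      of_real r * E (cube_op n p) + of_real s * E (cube_op n q)"
    using E op_deg_le_cube_op unfolding nc_pseudo_expectation_def by blast
  thus "Re (E (cube_op n (\<lambda>S. r * p S + s * q S))) =
      r * Re (E (cube_op n p)) + s * Re (E (cube_op n q))"
    by (simp add: cube_op_lincomb)
next
  show "Re (E (cube_op n (monomial {}))) = 1"
    using E by (simp add: cube_op_one nc_pseudo_expectation_def)
next
  fix p assume "mlpoly_deg_le n (d div 2) p"
  thus "0 \<le> Re (E (cube_op n (mlpoly_mult n p p)))"
    using E op_deg_le_cube_op unfolding nc_pseudo_expectation_def cube_op_mult by blast
qed

text \<open>Discards the off-diagonal entries, interpolates the real and imaginary parts of the
  diagonal by polynomials and extends \<open>E\<close> complex-linearly.\<close>

definition diag_expectation :: "nat \<Rightarrow> (mlpoly \<Rightarrow> real) \<Rightarrow> complex mat \<Rightarrow> complex" where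
  "diag_expectation n E A = Complex
     (E (walsh_coeffs n (\<lambda>r. Re (A $$ (r, r))))) (E (walsh_coeffs n (\<lambda>r. Im (A $$ (r, r)))))"

text \<open>By Fourier inversion. The bound \<open>e\<close> is independent of the level of a
  pseudo-expectation, so objectives of higher degree are covered.\<close>

lemma diag_expectation_eqI:
  assumes "mlpoly_deg_le n e p" "mlpoly_deg_le n e q"
    and "\<And>r. r < 2 ^ n \<Longrightarrow> A $$ (r, r) = Complex (cube_eval n p r) (cube_eval n q r)"
  shows "diag_expectation n E A = Complex (E p) (E q)"
proof -
  have "walsh_coeffs n (\<lambda>r. Re (A $$ (r, r))) = p"
    by (rule walsh_coeffs_eqI) (use assms in auto)
  moreover have "walsh_coeffs n (\<lambda>r. Im (A $$ (r, r))) = q"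
    by (rule walsh_coeffs_eqI) (use assms in auto)
  ultimately show ?thesis by (simp add: diag_expectation_def)
qed

lemma diag_expectation_cube_op:
  assumes "pseudo_expectation n d E" "mlpoly_deg_le n e p"
  shows "diag_expectation n E (cube_op n p) = of_real (E p)"
proof -
  have "diag_expectation n E (cube_op n p) = Complex (E p) (E (\<lambda>S. 0))"
    by (rule diag_expectation_eqI[OF assms(2)])
      (auto simp: mlpoly_deg_le_def cube_op_def cube_eval_def complex_eq_iff)
  thus ?thesis by (simp add: pseudo_expectation_zero[OF assms(1)] complex_eq_iff)
qed

text \<open>The diagonal of \<open>B\<^sup>\<dagger> B\<close> is the sum over \<open>a\<close> of the squared moduli of the functions
  \<open>r \<mapsto> B (r XOR a, r)\<close>, each of which has at most the degree of \<open>B\<close>.\<close>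

lemma diag_expectation_square:
  assumes E: "pseudo_expectation n d E" and B: "op_deg_le n (d div 2) B"
  shows "diag_expectation n E (mat_adjoint B * B) \<in> \<real>"
    and "0 \<le> Re (diag_expectation n E (mat_adjoint B * B))"
proof -
  \<comment> \<open>The bound on \<open>a\<close> stands inside the existential so that choice
    yields total functions.\<close>
  have "\<forall>a. \<exists>p q. a < 2 ^ n \<longrightarrow> mlpoly_deg_le n (d div 2) p \<and> mlpoly_deg_le n (d div 2) q \<and>
      (\<forall>r<2 ^ n. B $$ (r XOR a, r) = Complex (cube_eval n p r) (cube_eval n q r))"
    using op_deg_le_entries[OF B] by metis
  then obtain p q where
    pq: "\<And>a. a < 2 ^ n \<Longrightarrow> mlpoly_deg_le n (d div 2) (p a)"
        "\<And>a. a < 2 ^ n \<Longrightarrow> mlpoly_deg_le n (d div 2) (q a)"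
    and entry: "\<And>a r. a < 2 ^ n \<Longrightarrow> r < 2 ^ n \<Longrightarrow>
        B $$ (r XOR a, r) = Complex (cube_eval n (p a) r) (cube_eval n (q a) r)"
    by metis
  define s where "s a = (\<lambda>S. 1 * mlpoly_mult n (p a) (p a) S + 1 * mlpoly_mult n (q a) (q a) S)" for a
  \<comment> \<open>Twice \<open>d div 2\<close> is at most \<open>d\<close>, also for odd
    \<open>d\<close>.\<close>
  have deg2: "mlpoly_deg_le n d (mlpoly_mult n f f)" if "mlpoly_deg_le n (d div 2) f" for f
    using mlpoly_deg_le_mult[OF that that] unfolding mlpoly_deg_le_def by fastforce
  have deg: "mlpoly_deg_le n d (s a)" if "a < 2 ^ n" for a
    unfolding s_def using that pq by (intro mlpoly_deg_le_lincomb deg2) auto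
  have carr: "B \<in> carrier_mat (2 ^ n) (2 ^ n)" using op_deg_le_carrier[OF B] .
  have "diag_expectation n E (mat_adjoint B * B) =
      Complex (E (\<lambda>S. \<Sum>a<2 ^ n. s a S)) (E (\<lambda>S. 0))"
  proof (rule diag_expectation_eqI)
    show "mlpoly_deg_le n d (\<lambda>S. \<Sum>a<2 ^ n. s a S)" by (rule mlpoly_deg_le_sum) (auto simp: deg)
    fix r :: nat assume r: "r < 2 ^ n"
    have "(mat_adjoint B * B) $$ (r, r) = (\<Sum>l<2 ^ n. cnj (B $$ (l, r)) * B $$ (l, r))"
      by (rule mat_adjoint_mult_entry[OF carr r r])
    \<comment> \<open>Row \<open>l\<close> is written as \<open>r XOR a\<close>, so that for fixed
      \<open>a\<close> the summand is a function of \<open>r\<close> of bounded degree.\<close>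
    also have "\<dots> = (\<Sum>a<2 ^ n. cnj (B $$ (r XOR a, r)) * B $$ (r XOR a, r))"
      by (rule sum.reindex_bij_betw[OF bij_betw_xor[OF r], symmetric])
    \<comment> \<open>The squared modulus is the sum of the squares of real and imaginary
      part.\<close>
    also have "\<dots> = (\<Sum>a<2 ^ n. of_real (cube_eval n (s a) r))"
      using r by (intro sum.cong)
        (auto simp: entry s_def cube_eval_lincomb[of _ 1 _ 1, simplified] cube_eval_mult complex_eq_iff)
    finally show "(mat_adjoint B * B) $$ (r, r) =
        Complex (cube_eval n (\<lambda>S. \<Sum>a<2 ^ n. s a S) r) (cube_eval n (\<lambda>S. 0) r)"
      by (simp add: cube_eval_sum cube_eval_def[of n "\<lambda>S. 0"] complex_eq_iff)
  qed (simp add: mlpoly_deg_le_def)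
  hence eq: "diag_expectation n E (mat_adjoint B * B) = of_real (\<Sum>a<2 ^ n. E (s a))"
    using pseudo_expectation_sum[OF E, of "{..<2 ^ n}" s] deg
    by (simp add: pseudo_expectation_zero[OF E] complex_eq_iff)
  have "0 \<le> E (s a)" if a: "a < 2 ^ n" for a
  proof -
    have "E (s a) = 1 * E (mlpoly_mult n (p a) (p a)) + 1 * E (mlpoly_mult n (q a) (q a))"
      using E a pq deg2 unfolding s_def pseudo_expectation_def by blast
    thus ?thesis using E a pq by (simp add: pseudo_expectation_def)
  qed
  thus "0 \<le> Re (diag_expectation n E (mat_adjoint B * B))"
    unfolding eq by (auto intro: sum_nonneg)
  show "diag_expectation n E (mat_adjoint B * B) \<in> \<real>" unfolding eq by simp
qed

lemma diag_expectation_lincomb: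
  assumes E: "pseudo_expectation n d E" and A: "op_deg_le n d A" and B: "op_deg_le n d B"
  shows "diag_expectation n E (u \<cdot>\<^sub>m A + v \<cdot>\<^sub>m B) =
    u * diag_expectation n E A + v * diag_expectation n E B"
proof -
  have diag: "\<exists>p q. mlpoly_deg_le n d p \<and> mlpoly_deg_le n d q \<and>
      (\<forall>r<2 ^ n. M $$ (r, r) = Complex (cube_eval n p r) (cube_eval n q r))"
    if "op_deg_le n d M" for M
    using op_deg_le_entries[OF that, of 0] by (simp, metis)
  obtain p q where pq: "mlpoly_deg_le n d p" "mlpoly_deg_le n d q"
    and pq_eq: "\<And>r. r < 2 ^ n \<Longrightarrow> A $$ (r, r) = Complex (cube_eval n p r) (cube_eval n q r)"
    using diag[OF A] by blast
  obtain f g where fg: "mlpoly_deg_le n d f" "mlpoly_deg_le n d g"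
    and fg_eq: "\<And>r. r < 2 ^ n \<Longrightarrow> B $$ (r, r) = Complex (cube_eval n f r) (cube_eval n g r)"
    using diag[OF B] by blast
  \<comment> \<open>Real and imaginary parts of the combined diagonal; the factors 1 give both the
    shape to which linearity of \<open>E\<close> applies.\<close>
  define re where "re = (\<lambda>S. 1 * (Re u * p S + (- Im u) * q S) + 1 * (Re v * f S + (- Im v) * g S))"
  define im where "im = (\<lambda>S. 1 * (Im u * p S + Re u * q S) + 1 * (Im v * f S + Re v * g S))"
  have lin: "E (\<lambda>S. x * p S + y * q S) = x * E p + y * E q"
    if "mlpoly_deg_le n d p" "mlpoly_deg_le n d q" for p q x y
    using E that unfolding pseudo_expectation_def by blast
  have "diag_expectation n E (u \<cdot>\<^sub>m A + v \<cdot>\<^sub>m B) = Complex (E re) (E im)"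
  proof (rule diag_expectation_eqI)
    show "mlpoly_deg_le n d re" "mlpoly_deg_le n d im"
      unfolding re_def im_def by (intro mlpoly_deg_le_lincomb pq fg)+
    fix r :: nat assume r: "r < 2 ^ n"
    have "(u \<cdot>\<^sub>m A + v \<cdot>\<^sub>m B) $$ (r, r) = u * A $$ (r, r) + v * B $$ (r, r)"
      using r op_deg_le_carrier[OF A] op_deg_le_carrier[OF B] by auto
    thus "(u \<cdot>\<^sub>m A + v \<cdot>\<^sub>m B) $$ (r, r) = Complex (cube_eval n re r) (cube_eval n im r)"
      unfolding re_def im_def cube_eval_lincomb using r
      by (simp add: pq_eq fg_eq complex_eq_iff)
  qed
  moreover have "E re = Re u * E p - Im u * E q + (Re v * E f - Im v * E g)"
    unfolding re_def by (simp only: lin mlpoly_deg_le_lincomb pq fg) simp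
  moreover have "E im = Im u * E p + Re u * E q + (Im v * E f + Re v * E g)"
    unfolding im_def by (simp only: lin mlpoly_deg_le_lincomb pq fg) simp
  moreover have "diag_expectation n E A = Complex (E p) (E q)"
    by (rule diag_expectation_eqI[OF pq pq_eq])
  moreover have "diag_expectation n E B = Complex (E f) (E g)"
    by (rule diag_expectation_eqI[OF fg fg_eq])
  ultimately show ?thesis by (simp add: complex_eq_iff)
qed

lemma nc_pseudo_expectation_diag:
  assumes E: "pseudo_expectation n d E"
  shows "nc_pseudo_expectation n d (diag_expectation n E)"
proof -
  have "diag_expectation n E (1\<^sub>m (2 ^ n)) = of_real (E (monomial {}))"
    unfolding cube_op_one[symmetric]
    by (rule diag_expectation_cube_op[OF E mlpoly_deg_le_monomial[where d = 0]]) auto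
  thus ?thesis
    using E diag_expectation_lincomb[OF E] diag_expectation_square[OF E]
    unfolding nc_pseudo_expectation_def pseudo_expectation_def by simp
qed

text \<open>The suprema are compared functional by functional in both directions, which also covers
  infinite values.\<close>

lemma nc_sos_value_cube_op:
  assumes "mlpoly_deg_le n e p"
  shows "nc_sos_value n d (cube_op n p) = sos_value n d p"
proof (rule antisym)
  show "nc_sos_value n d (cube_op n p) \<le> sos_value n d p"
    unfolding nc_sos_value_def sos_value_def
    by (rule SUP_mono) (use pseudo_expectation_cube_op in fastforce)
  show "sos_value n d p \<le> nc_sos_value n d (cube_op n p)"
    unfolding nc_sos_value_def sos_value_def
  proof (rule SUP_mono)
    fix E assume "E \<in> {E. pseudo_expectation n d E}"
    hence E: "pseudo_expectation n d E" by simp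
    show "\<exists>F\<in>{F. nc_pseudo_expectation n d F}. ereal (E p) \<le> ereal (Re (F (cube_op n p)))"
      using nc_pseudo_expectation_diag[OF E] diag_expectation_cube_op[OF E assms] by auto
  qed
qed


subsection \<open>The reduction as a Turing machine\<close>

text \<open>Replacing letters takes one state and one pass to the right. On a blank,
  \<open>map_option\<close> returns \<open>None\<close>, which halts the machine.\<close>

definition subst_machine :: "(char \<Rightarrow> char) \<Rightarrow> turing_machine" where
  "subst_machine f = (1, \<lambda>q. map_option (\<lambda>a. (0, Some (f a), Move_Right)))"

lemma subst_machine_steps:
  assumes "T \<le> length w"
  shows "(tm_step (subst_machine f) ^^ T) (0, tape_of w, 0) =
    (0, tape_of (map f (take T w) @ drop T w), int T)"
  using assms
proof (induction T)
  case (Suc T)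
  let ?t = "tape_of (map f (take T w) @ drop T w)"
  have head: "?t (int T) = Some (w ! T)"
    using Suc.prems by (simp add: tape_of_def nth_append)
  have "?t(int T := Some (f (w ! T))) = tape_of (map f (take (Suc T) w) @ drop (Suc T) w)"
  proof
    fix i
    show "(?t(int T := Some (f (w ! T)))) i = tape_of (map f (take (Suc T) w) @ drop (Suc T) w) i"
      using Suc.prems
      by (cases "nat i < T"; cases "i = int T")
        (auto simp: tape_of_def nth_append nth_Cons' min_def)
  qed
  with Suc head show ?case by (simp add: subst_machine_def)
qed simp

lemma subst_machine_computes:
  "computes_within (subst_machine f) (length w) w (map f w)"
  using subst_machine_steps[of "length w" w f]
  by (simp add: computes_within_def subst_machine_def tape_of_def)

text \<open>Ensures that replacing the letter \<open>x\<close> leaves numerals intact.\<close>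

lemma set_binary: "set (binary m) \<subseteq> {CHR ''0'', CHR ''1''}"
proof (induction m rule: binary.induct)
  case (1 m)
  thus ?case by (subst binary.simps) auto
qed

text \<open>The order \<open>Cs\<close> of the constraints is kept. Digits and signs differ from
  \<open>x\<close>, so only the variable letters change.\<close>

lemma map_subst_description:
  fixes f :: "char \<Rightarrow> char"
  defines "f \<equiv> id(CHR ''x'' := CHR ''Z'')"
  assumes "xor_instance k n H b" "xor_description n H b w"
  shows "ham_xor_description n H Z_string b (map f w)"
proof -
  obtain Cs where Cs: "distinct Cs" "set Cs = H" and
    w: "w = binary n @ concat (map (\<lambda>C. sign_char (b C) #
          concat (map (\<lambda>i. CHR ''x'' # binary i) (sorted_list_of_set C))) Cs)"
    using assms unfolding xor_description_def by blast
  have bin: "map f (binary m) = binary m" for m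
    using set_binary[of m] by (intro map_idI) (auto simp: f_def)
  have "f (sign_char (b C)) = sign_char (b C)" for C by (simp add: f_def sign_char_def)
  moreover have "map f (concat (map (\<lambda>i. CHR ''x'' # binary i) (sorted_list_of_set C))) =
      concat (map (\<lambda>i. pauli_char (Z_string C i) # binary i) (sorted_list_of_set C))"
    if "C \<in> H" for C
  proof -
    \<comment> \<open>Finiteness makes \<open>sorted_list_of_set C\<close> list exactly the elements
      of \<open>C\<close>, where \<open>Z_string C\<close> is \<open>PZ\<close>.\<close>
    have "finite C" using that assms by (auto simp: xor_instance_def intro: finite_subset)
    hence "map (\<lambda>i. f (CHR ''x'') # binary i) (sorted_list_of_set C) =
        map (\<lambda>i. pauli_char (Z_string C i) # binary i) (sorted_list_of_set C)"
      by (intro map_cong) (auto simp: f_def Z_string_def)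
    thus ?thesis by (simp only: map_concat map_map o_def list.map bin)
  qed
  ultimately have "map (\<lambda>C. map f (sign_char (b C) #
        concat (map (\<lambda>i. CHR ''x'' # binary i) (sorted_list_of_set C)))) Cs =
      map (\<lambda>C. sign_char (b C) #
        concat (map (\<lambda>i. pauli_char (Z_string C i) # binary i) (sorted_list_of_set C))) Cs"
    using Cs by (intro map_cong) (simp_all only: list.map)
  hence "map f w = binary n @ concat (map (\<lambda>C. sign_char (b C) #
      concat (map (\<lambda>i. pauli_char (Z_string C i) # binary i) (sorted_list_of_set C))) Cs)"
    by (simp only: w map_append map_concat[of f "map _ Cs"] map_map o_def bin)
  thus ?thesis using Cs unfolding ham_xor_description_def by blast
qed

theorem theorem1p5:
  fixes k :: nat
  assumes "k \<ge> 2"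
  shows
    "(\<exists>(M :: turing_machine) (T :: nat poly). wf_turing_machine M \<and>
        (\<forall>n H b w. xor_instance k n H b \<longrightarrow> xor_description n H b w \<longrightarrow>
           (\<exists>w'. ham_xor_description n H Z_string b w' \<and>
                 computes_within M (poly T (length w)) w w'))) \<and>
     (\<forall>n H b. xor_instance k n H b \<longrightarrow>
        ham_xor_instance k n H Z_string b \<and>
        xor_val n H b = lambda_max (xor_hamiltonian n H Z_string b) \<and>
        (\<forall>d. nc_sos_value n d (xor_hamiltonian n H Z_string b)
             = sos_value n d (xor_poly H b)))"
proof (intro conjI allI impI)
  let ?f = "id(CHR ''x'' := CHR ''Z'')"
  have "wf_turing_machine (subst_machine ?f)"
    by (auto simp: wf_turing_machine_def subst_machine_def)
  \<comment> \<open>The polynomial \<open>[:0, 1:]\<close> is the identity: one step per input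
    symbol.\<close>
  moreover have "computes_within (subst_machine ?f) (poly [:0, 1:] (length w)) w (map ?f w)" for w
    using subst_machine_computes by simp
  ultimately show "\<exists>(M :: turing_machine) (T :: nat poly). wf_turing_machine M \<and>
      (\<forall>n H b w. xor_instance k n H b \<longrightarrow> xor_description n H b w \<longrightarrow>
         (\<exists>w'. ham_xor_description n H Z_string b w' \<and>
               computes_within M (poly T (length w)) w w'))"
    using map_subst_description by blast
next
  fix n H b d assume I: "xor_instance k n H b"
  show "ham_xor_instance k n H Z_string b"
    using I by (auto simp: ham_xor_instance_def xor_instance_def pauli_supp_Z_string
        Z_string_in_pauli_strings)
  show "xor_val n H b = lambda_max (xor_hamiltonian n H Z_string b)"
    by (rule xor_val_eq_lambda_max[OF I])
  show "nc_sos_value n d (xor_hamiltonian n H Z_string b) = sos_value n d (xor_poly H b)"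
    unfolding xor_hamiltonian_eq_cube_op[OF I]
    by (rule nc_sos_value_cube_op[OF mlpoly_deg_le_xor_poly[OF I]])
qed

end
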